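(* Let $\mathcal{P}$ be an $\mathrm{ASP^{fs}}$ program and $\mathcal{Q}$ a query that is finitely recursive on $\mathcal{P}$. Then $\mathrm{DMS}(\mathcal{Q},\mathcal{P})$ is finitely ground.
   Context: Terms are variables or functional terms $f(t_1,\dots,t_k)$ ($k\ge0$). A rule $r$: $a_1 \vee \dots \vee a_n \leftarrow b_1,\dots,b_j,\mathrm{not}\,b_{j+1},\dots,\mathrm{not}\,b_m$ ($n\ge1$); $H(r)$, $B^+(r)$, $B^-(r)$ denote head atoms, positive and negative body atoms, $\mathrm{atoms}(r)$ their union. A program is a finite set of rules; it is stratified if no cycle of predicate dependencies (head predicate depends on body predicates) contains a negative dependency. An $\mathrm{ASP^{fs}}$ program is a stratified program with disjunction and function symbols allowed. A fact is a variable-free rule with empty body and one head atom. A predicate is EDB if all rules defining it are facts, IDB otherwise; $\mathrm{EDB}(\mathcal{P})$ is the set of rules of $\mathcal{P}$ with no IDB predicate in head. $\mathrm{Ground}(\mathcal{P})$ is the set of ground instances over the ground terms built from the function symbols of $\mathcal{P}$. A query is a ground atom $\mathcal{Q}=g(\bar t)$ with function symbols in $\mathcal{P}$. Relevant atoms for $\mathcal{Q}$: $\mathcal{Q}$, and all atoms of $\mathrm{atoms}(r_g)$ for $r_g\in\mathrm{Ground}(\mathcal{P})$ with a relevant head atom; $\mathcal{Q}$ is finitely recursive on $\mathcal{P}$ if finitely many ground atoms are relevant. $\mathrm{DMS}(\mathcal{Q},\mathcal{P})$: with fresh predicates $\mathrm{magic\_}p$ (same arity as $p$), initialize $D=\emptyset$,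 $\mathit{modifiedRules}=\emptyset$, $\mathit{magicRules}=\{\mathrm{magic\_}g(\bar t).\}$, $S=\{g\}$; while $S\neq\emptyset$, move a predicate $p$ from $S$ to $D$, and for each $r\in\mathcal{P}$ and each $p(\bar t)\in H(r)$: add to $\mathit{modifiedRules}$ the rule $r$ with $\mathrm{magic\_}q(\bar s)$ added to the body for every $q(\bar s)\in H(r)$; for each $q(\bar s)\in\mathrm{atoms}(r)\setminus\{p(\bar t)\}$ with $q$ IDB, add $\mathrm{magic\_}q(\bar s)\leftarrow\mathrm{magic\_}p(\bar t)$ to $\mathit{magicRules}$ and add $q$ to $S$ if $q\notin D$. Output $\mathit{magicRules}\cup\mathit{modifiedRules}\cup\mathrm{EDB}(\mathcal{P})$. Finitely ground programs: the dependency graph of a program $\mathcal{P}$ has the IDB predicates as nodes and an edge $q\to p$ if some rule has $p$ in its head and $q$ in its positive body; components are its strongly connected components. The component graph has components as nodes, an edge $C'\to^{+}C$ if some rule has a predicate of $C$ in its head and one of $C'$ in its positive body, and an edge $C'\to^{-}C$ if there is no $+$ edge from $C'$ to $C$ and some rule has a predicate of $C$ in its head and one of $C'$ in its negative body. A path is weak if it has a $-$ edge, strong otherwise. A component ordering is a total ordering $\gamma=\langle C_1,\dots,C_n\rangle$ of all components such that for $i<j$ there is no strong path from $C_j$ to $C_i$, and if there is a weak path from $C_j$ to $C_i$ then there is a weak path from $C_i$ to $C_j$. The module $P(C_i)$ is the set of rules defining a predicate of $C_i$, excluding those that also define a predicate of some $C_j$, $j<i$. For a set $A$ of ground atoms,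 $\mathrm{Inst}_{P}(A)$ is the set of ground instances $r_g$ of rules of $P$ with $B^+(r_g)\subseteq A$. For sets $T,R$ of ground rules (relative to $C_i$), $\mathrm{Simpl}(T,R)$ is obtained from $T$ by deleting every rule $r_g$ such that $H(r_g)\cup B^-(r_g)$ contains an atom that is a fact in $R$, and then removing from each remaining rule the atoms of $B^+(r_g)$ that are facts in $R$ and each negative literal $\mathrm{not}\,p(\bar t)$ with $p\in C_j$ for some $j<i$ and no rule of $R$ having $p(\bar t)$ in its head. Let $\Phi_{P(C_i),R}(S)=\mathrm{Simpl}(\mathrm{Inst}_{P(C_i)}(A),R)$ where $A$ is the set of atoms occurring in heads of rules of $R\cup S$, and $\Phi^\infty_{P(C_i),R}(\emptyset)$ its least fixpoint. Set $\mathcal{P}^\gamma_0=\mathrm{EDB}(\mathcal{P})$, $\mathcal{P}^\gamma_i=\mathcal{P}^\gamma_{i-1}\cup\Phi^\infty_{P(C_i),\mathcal{P}^\gamma_{i-1}}(\emptyset)$, and $\mathcal{P}^\gamma=\mathcal{P}^\gamma_n$. $\mathcal{P}$ is finitely ground if $\mathcal{P}^\gamma$ is finite for every component ordering $\gamma$ of $\mathcal{P}$. *)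

theory Defs
  imports Main
begin

section \<open>Syntax\<close>

datatype ('f, 'v) trm = Var 'v | Fun 'f "('f, 'v) trm list"

datatype ('p, 'f, 'v) atom = Atom (pred: 'p) (args: "('f, 'v) trm list")

text \<open>The fields are H(r), B+(r) and B-(r).\<close>

datatype ('p, 'f, 'v) asp_rule =
  Rule (hd_atoms: "('p, 'f, 'v) atom set")
       (pos_body: "('p, 'f, 'v) atom set")
       (neg_body: "('p, 'f, 'v) atom set")

type_synonym ('p, 'f, 'v) program = "('p, 'f, 'v) asp_rule set"

definition atoms :: "('p, 'f, 'v) asp_rule \<Rightarrow> ('p, 'f, 'v) atom set" where
  "atoms r = hd_atoms r \<union> pos_body r \<union> neg_body r"

definition is_program :: "('p, 'f, 'v) program \<Rightarrow> bool" where
  "is_program P \<longleftrightarrow> finite P \<and> (\<forall>r\<in>P. finite (atoms r) \<and> hd_atoms r \<noteq> {})"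

fun vars_trm :: "('f, 'v) trm \<Rightarrow> 'v set" where
  "vars_trm (Var x) = {x}"
| "vars_trm (Fun f ts) = (\<Union>t\<in>set ts. vars_trm t)"

definition vars_atom :: "('p, 'f, 'v) atom \<Rightarrow> 'v set" where
  "vars_atom a = (\<Union>t\<in>set (args a). vars_trm t)"

definition vars_rule :: "('p, 'f, 'v) asp_rule \<Rightarrow> 'v set" where
  "vars_rule r = (\<Union>a\<in>atoms r. vars_atom a)"

text \<open>A function symbol is a name together with an arity, so that a name used with a fixed
  arity in a program is also used with this arity only in its ground terms. Predicate symbols
  carry no arity: if each is used with one arity only, then so are their magic versions.\<close>

fun funs_trm :: "('f, 'v) trm \<Rightarrow> ('f \<times> nat) set" where
  "funs_trm (Var x) = {}"
| "funs_trm (Fun f ts) = insert (f, length ts) (\<Union>t\<in>set ts. funs_trm t)"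

definition funs_program :: "('p, 'f, 'v) program \<Rightarrow> ('f \<times> nat) set" where
  "funs_program P = (\<Union>r\<in>P. \<Union>a\<in>atoms r. \<Union>t\<in>set (args a). funs_trm t)"

definition defines_pred :: "('p, 'f, 'v) asp_rule \<Rightarrow> 'p \<Rightarrow> bool" where
  "defines_pred r p \<longleftrightarrow> p \<in> pred ` hd_atoms r"

definition is_fact :: "('p, 'f, 'v) asp_rule \<Rightarrow> bool" where
  "is_fact r \<longleftrightarrow> vars_rule r = {} \<and> (\<exists>a. r = Rule {a} {} {})"

definition idb :: "('p, 'f, 'v) program \<Rightarrow> 'p set" where
  "idb P = {p. \<not> (\<forall>r\<in>P. defines_pred r p \<longrightarrow> is_fact r)}"

definition EDB :: "('p, 'f, 'v) program \<Rightarrow> ('p, 'f, 'v) program" where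
  "EDB P = {r\<in>P. pred ` hd_atoms r \<inter> idb P = {}}"


section \<open>Stratification\<close>

definition pred_dep :: "('p, 'f, 'v) program \<Rightarrow> ('p \<times> 'p) set" where
  "pred_dep P =
     {(p, q). \<exists>r\<in>P. p \<in> pred ` hd_atoms r \<and> q \<in> pred ` (pos_body r \<union> neg_body r)}"

definition neg_pred_dep :: "('p, 'f, 'v) program \<Rightarrow> ('p \<times> 'p) set" where
  "neg_pred_dep P = {(p, q). \<exists>r\<in>P. p \<in> pred ` hd_atoms r \<and> q \<in> pred ` neg_body r}"

text \<open>A negative dependency of p on q lies on a cycle iff q depends transitively on p.\<close>

definition stratified :: "('p, 'f, 'v) program \<Rightarrow> bool" where
  "stratified P \<longleftrightarrow> \<not> (\<exists>(p, q)\<in>neg_pred_dep P. (q, p) \<in> (pred_dep P)\<^sup>*)"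

definition ASP_fs :: "('p, 'f, 'v) program \<Rightarrow> bool" where
  "ASP_fs P \<longleftrightarrow> is_program P \<and> stratified P"


section \<open>Grounding and relevance\<close>

definition ground_terms :: "('p, 'f, 'v) program \<Rightarrow> ('f, 'v) trm set" where
  "ground_terms P = {t. vars_trm t = {} \<and> funs_trm t \<subseteq> funs_program P}"

fun subst_trm :: "('v \<Rightarrow> ('f, 'v) trm) \<Rightarrow> ('f, 'v) trm \<Rightarrow> ('f, 'v) trm" where
  "subst_trm \<sigma> (Var x) = \<sigma> x"
| "subst_trm \<sigma> (Fun f ts) = Fun f (map (subst_trm \<sigma>) ts)"

definition subst_atom :: "('v \<Rightarrow> ('f, 'v) trm) \<Rightarrow> ('p, 'f, 'v) atom \<Rightarrow> ('p, 'f, 'v) atom" where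
  "subst_atom \<sigma> a = Atom (pred a) (map (subst_trm \<sigma>) (args a))"

definition subst_rule ::
  "('v \<Rightarrow> ('f, 'v) trm) \<Rightarrow> ('p, 'f, 'v) asp_rule \<Rightarrow> ('p, 'f, 'v) asp_rule" where
  "subst_rule \<sigma> r =
     Rule (subst_atom \<sigma> ` hd_atoms r) (subst_atom \<sigma> ` pos_body r) (subst_atom \<sigma> ` neg_body r)"

text \<open>Only the variables of the rule have to be mapped into U, so that a variable-free rule is an
  instance of itself even if U is empty.\<close>

definition instances ::
  "('f, 'v) trm set \<Rightarrow> ('p, 'f, 'v) asp_rule \<Rightarrow> ('p, 'f, 'v) asp_rule set" where
  "instances U r = {subst_rule \<sigma> r | \<sigma>. \<forall>x\<in>vars_rule r. \<sigma> x \<in> U}"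

definition Ground :: "('p, 'f, 'v) program \<Rightarrow> ('p, 'f, 'v) program" where
  "Ground P = (\<Union>r\<in>P. instances (ground_terms P) r)"

definition is_query :: "('p, 'f, 'v) program \<Rightarrow> ('p, 'f, 'v) atom \<Rightarrow> bool" where
  "is_query P Q \<longleftrightarrow> set (args Q) \<subseteq> ground_terms P"

inductive_set relevant :: "('p, 'f, 'v) program \<Rightarrow> ('p, 'f, 'v) atom \<Rightarrow> ('p, 'f, 'v) atom set"
  for P :: "('p, 'f, 'v) program" and Q :: "('p, 'f, 'v) atom" where
  query: "Q \<in> relevant P Q"
| step: "r \<in> Ground P \<Longrightarrow> h \<in> hd_atoms r \<Longrightarrow> h \<in> relevant P Q \<Longrightarrow> a \<in> atoms r
    \<Longrightarrow> a \<in> relevant P Q"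

definition finitely_recursive :: "('p, 'f, 'v) program \<Rightarrow> ('p, 'f, 'v) atom \<Rightarrow> bool" where
  "finitely_recursive P Q \<longleftrightarrow> finite (relevant P Q)"


section \<open>The magic set transformation\<close>

datatype 'p mpred = Orig 'p | Magic 'p

definition orig_atom :: "('p, 'f, 'v) atom \<Rightarrow> ('p mpred, 'f, 'v) atom" where
  "orig_atom a = Atom (Orig (pred a)) (args a)"

definition magic_atom :: "('p, 'f, 'v) atom \<Rightarrow> ('p mpred, 'f, 'v) atom" where
  "magic_atom a = Atom (Magic (pred a)) (args a)"

definition orig_rule :: "('p, 'f, 'v) asp_rule \<Rightarrow> ('p mpred, 'f, 'v) asp_rule" where
  "orig_rule r =
     Rule (orig_atom ` hd_atoms r) (orig_atom ` pos_body r) (orig_atom ` neg_body r)"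

definition modify_rule :: "('p, 'f, 'v) asp_rule \<Rightarrow> ('p mpred, 'f, 'v) asp_rule" where
  "modify_rule r =
     Rule (orig_atom ` hd_atoms r)
          (orig_atom ` pos_body r \<union> magic_atom ` hd_atoms r)
          (orig_atom ` neg_body r)"

text \<open>The contributions made when a predicate p is processed.\<close>

definition modified_for :: "('p, 'f, 'v) program \<Rightarrow> 'p \<Rightarrow> ('p mpred, 'f, 'v) program" where
  "modified_for P p = {modify_rule r | r a. r \<in> P \<and> a \<in> hd_atoms r \<and> pred a = p}"

definition magic_for :: "('p, 'f, 'v) program \<Rightarrow> 'p \<Rightarrow> ('p mpred, 'f, 'v) program" where
  "magic_for P p = {Rule {magic_atom b} {magic_atom a} {} | r a b.
     r \<in> P \<and> a \<in> hd_atoms r \<and> pred a = p \<and> b \<in> atoms r - {a} \<and> pred b \<in> idb P}"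

definition called_by :: "('p, 'f, 'v) program \<Rightarrow> 'p \<Rightarrow> 'p set" where
  "called_by P p = {pred b | r a b.
     r \<in> P \<and> a \<in> hd_atoms r \<and> pred a = p \<and> b \<in> atoms r - {a} \<and> pred b \<in> idb P}"

text \<open>A state consists of S, D, modifiedRules and magicRules. One step is one iteration of the
  while loop, with any choice of a predicate in S.\<close>

type_synonym ('p, 'f, 'v) dms_state =
  "'p set \<times> 'p set \<times> ('p mpred, 'f, 'v) program \<times> ('p mpred, 'f, 'v) program"

definition dms_init :: "('p, 'f, 'v) atom \<Rightarrow> ('p, 'f, 'v) dms_state" where
  "dms_init Q = ({pred Q}, {}, {}, {Rule {magic_atom Q} {} {}})"

inductive dms_step ::
  "('p, 'f, 'v) program \<Rightarrow> ('p, 'f, 'v) dms_state \<Rightarrow> ('p, 'f, 'v) dms_state \<Rightarrow> bool"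
  for P :: "('p, 'f, 'v) program" where
  "p \<in> S \<Longrightarrow> dms_step P (S, D, modified, magic)
     ((S - {p}) \<union> (called_by P p - insert p D), insert p D,
      modified \<union> modified_for P p, magic \<union> magic_for P p)"

definition dms_output ::
  "('p, 'f, 'v) atom \<Rightarrow> ('p, 'f, 'v) program \<Rightarrow> ('p mpred, 'f, 'v) program \<Rightarrow> bool" where
  "dms_output Q P M \<longleftrightarrow> (\<exists>D modified magic.
     (dms_step P)\<^sup>*\<^sup>* (dms_init Q) ({}, D, modified, magic) \<and>
     M = magic \<union> modified \<union> orig_rule ` EDB P)"

text \<open>For a program P there is exactly one output, independently of the choices made; see
  \<open>dms_output_ex1\<close> below.\<close>

definition DMS ::
  "('p, 'f, 'v) atom \<Rightarrow> ('p, 'f, 'v) program \<Rightarrow> ('p mpred, 'f, 'v) program" where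
  "DMS Q P = (THE M. dms_output Q P M)"

definition reached :: "('p, 'f, 'v) atom \<Rightarrow> ('p, 'f, 'v) program \<Rightarrow> 'p set" where
  "reached Q P = {p. (pred Q, p) \<in> {(p, q). q \<in> called_by P p}\<^sup>*}"

lemma dms_invariant:
  assumes "(dms_step P)\<^sup>*\<^sup>* (dms_init Q) (S, D, modified, magic)"
  shows "S \<inter> D = {} \<and> pred Q \<in> S \<union> D \<and> S \<union> D \<subseteq> reached Q P \<and>
    (\<forall>p\<in>D. called_by P p \<subseteq> S \<union> D) \<and> modified = (\<Union>p\<in>D. modified_for P p) \<and>
    magic = insert (Rule {magic_atom Q} {} {}) (\<Union>p\<in>D. magic_for P p)"
  using assms
proof (induction "(S, D, modified, magic)" arbitrary: S D modified magic rule: rtranclp_induct)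
  case base
  then show ?case by (auto simp: dms_init_def reached_def)
next
  case (step st)
  obtain S0 D0 mo0 ma0 where st: "st = (S0, D0, mo0, ma0)" by (cases st) auto
  note IH = step.hyps(3)[OF st]
  from step.hyps(2)[unfolded st] obtain p where p: "p \<in> S0"
    and eq: "S = (S0 - {p}) \<union> (called_by P p - insert p D0)" "D = insert p D0"
      "modified = mo0 \<union> modified_for P p" "magic = ma0 \<union> magic_for P p"
    by (auto elim: dms_step.cases)
  have "p \<in> reached Q P" using p IH by auto
  then have "called_by P p \<subseteq> reached Q P"
    by (auto simp: reached_def intro: rtrancl_into_rtrancl)
  then show ?case using p IH unfolding eq by auto
qed

lemma finite_reached:
  assumes "is_program P"
  shows "finite (reached Q P)"
proof -
  have "reached Q P \<subseteq> insert (pred Q) (\<Union>r\<in>P. pred ` atoms r)"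
  proof
    fix p assume "p \<in> reached Q P"
    then have "(pred Q, p) \<in> {(p, q). q \<in> called_by P p}\<^sup>*" by (simp add: reached_def)
    then show "p \<in> insert (pred Q) (\<Union>r\<in>P. pred ` atoms r)"
      by (cases rule: rtranclE) (auto simp: called_by_def)
  qed
  then show ?thesis
    using assms by (auto simp: is_program_def intro: finite_subset)
qed

lemma dms_terminates:
  assumes "is_program P" and "(dms_step P)\<^sup>*\<^sup>* (dms_init Q) (S, D, modified, magic)"
  shows "\<exists>D' modified' magic'. (dms_step P)\<^sup>*\<^sup>* (dms_init Q) ({}, D', modified', magic')"
  using assms(2)
proof (induction "card (reached Q P - D)" arbitrary: S D modified magic rule: less_induct)
  case less
  show ?case
  proof (cases "S = {}")
    case True
    then show ?thesis using less.prems by blast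
  next
    case False
    then obtain p where p: "p \<in> S" by blast
    note inv = dms_invariant[OF less.prems]
    have "reached Q P - insert p D \<subset> reached Q P - D" using p inv by auto
    then have "card (reached Q P - insert p D) < card (reached Q P - D)"
      using finite_reached[OF assms(1)] by (intro psubset_card_mono) auto
    from less.hyps[OF this rtranclp.rtrancl_into_rtrancl[OF less.prems dms_step.intros[OF p]]]
    show ?thesis .
  qed
qed

lemma dms_final:
  assumes "(dms_step P)\<^sup>*\<^sup>* (dms_init Q) ({}, D, modified, magic)"
  shows "D = reached Q P" "modified = (\<Union>p\<in>reached Q P. modified_for P p)"
    "magic = insert (Rule {magic_atom Q} {} {}) (\<Union>p\<in>reached Q P. magic_for P p)"
proof -
  note inv = dms_invariant[OF assms]
  have "p \<in> D" if "(pred Q, p) \<in> {(p, q). q \<in> called_by P p}\<^sup>*" for p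
    using that by (induction rule: rtrancl_induct) (use inv in auto)
  then show "D = reached Q P" using inv by (auto simp: reached_def)
  with inv show "modified = (\<Union>p\<in>reached Q P. modified_for P p)"
    "magic = insert (Rule {magic_atom Q} {} {}) (\<Union>p\<in>reached Q P. magic_for P p)" by auto
qed

lemma dms_output_ex1:
  assumes "is_program P"
  shows "\<exists>!M. dms_output Q P M"
proof -
  obtain S D mo ma where "dms_init Q = (S, D, mo, ma)"
    by (cases "dms_init Q" rule: prod_cases4) auto
  then have "\<exists>M. dms_output Q P M"
    using dms_terminates[OF assms, of Q S D mo ma] unfolding dms_output_def by auto
  moreover have "M = M'" if "dms_output Q P M" "dms_output Q P M'" for M M'
    using that unfolding dms_output_def by (auto dest: dms_final)
  ultimately show ?thesis by blast
qed


section \<open>Finitely ground programs\<close>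

definition dep_graph :: "('p, 'f, 'v) program \<Rightarrow> ('p \<times> 'p) set" where
  "dep_graph P = {(q, p). q \<in> idb P \<and> p \<in> idb P \<and>
     (\<exists>r\<in>P. p \<in> pred ` hd_atoms r \<and> q \<in> pred ` pos_body r)}"

definition components :: "('p, 'f, 'v) program \<Rightarrow> 'p set set" where
  "components P =
     idb P // {(p, q). (p, q) \<in> (dep_graph P)\<^sup>* \<and> (q, p) \<in> (dep_graph P)\<^sup>*}"

definition pos_edge :: "('p, 'f, 'v) program \<Rightarrow> ('p set \<times> 'p set) set" where
  "pos_edge P = {(C', C). C' \<in> components P \<and> C \<in> components P \<and>
     (\<exists>r\<in>P. pred ` hd_atoms r \<inter> C \<noteq> {} \<and> pred ` pos_body r \<inter> C' \<noteq> {})}"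

definition neg_edge :: "('p, 'f, 'v) program \<Rightarrow> ('p set \<times> 'p set) set" where
  "neg_edge P = {(C', C). C' \<in> components P \<and> C \<in> components P \<and> (C', C) \<notin> pos_edge P \<and>
     (\<exists>r\<in>P. pred ` hd_atoms r \<inter> C \<noteq> {} \<and> pred ` neg_body r \<inter> C' \<noteq> {})}"

definition strong_path :: "('p, 'f, 'v) program \<Rightarrow> 'p set \<Rightarrow> 'p set \<Rightarrow> bool" where
  "strong_path P C C' \<longleftrightarrow> (C, C') \<in> (pos_edge P)\<^sup>+"

definition weak_path :: "('p, 'f, 'v) program \<Rightarrow> 'p set \<Rightarrow> 'p set \<Rightarrow> bool" where
  "weak_path P C C' \<longleftrightarrow>
     (C, C') \<in> (pos_edge P \<union> neg_edge P)\<^sup>* O neg_edge P O (pos_edge P \<union> neg_edge P)\<^sup>*"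

definition component_ordering :: "('p, 'f, 'v) program \<Rightarrow> 'p set list \<Rightarrow> bool" where
  "component_ordering P \<gamma> \<longleftrightarrow> distinct \<gamma> \<and> set \<gamma> = components P \<and>
     (\<forall>i j. i < j \<and> j < length \<gamma> \<longrightarrow>
        \<not> strong_path P (\<gamma> ! j) (\<gamma> ! i) \<and>
        (weak_path P (\<gamma> ! j) (\<gamma> ! i) \<longrightarrow> weak_path P (\<gamma> ! i) (\<gamma> ! j)))"

text \<open>Positions in a component ordering are counted from 0 below.\<close>

definition module :: "('p, 'f, 'v) program \<Rightarrow> 'p set list \<Rightarrow> nat \<Rightarrow> ('p, 'f, 'v) program" where
  "module P \<gamma> i = {r\<in>P. (\<exists>p\<in>\<gamma> ! i. defines_pred r p) \<and> \<not> (\<exists>j<i. \<exists>p\<in>\<gamma> ! j. defines_pred r p)}"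

definition Inst ::
  "('f, 'v) trm set \<Rightarrow> ('p, 'f, 'v) program \<Rightarrow> ('p, 'f, 'v) atom set \<Rightarrow> ('p, 'f, 'v) program" where
  "Inst U M A = {rg. (\<exists>r\<in>M. rg \<in> instances U r) \<and> pos_body rg \<subseteq> A}"

definition facts_in :: "('p, 'f, 'v) program \<Rightarrow> ('p, 'f, 'v) atom set" where
  "facts_in R = {a. Rule {a} {} {} \<in> R \<and> is_fact (Rule {a} {} {})}"

definition heads_in :: "('p, 'f, 'v) program \<Rightarrow> ('p, 'f, 'v) atom set" where
  "heads_in R = (\<Union>r\<in>R. hd_atoms r)"

definition simpl_rule :: "'p set list \<Rightarrow> nat \<Rightarrow> ('p, 'f, 'v) program \<Rightarrow>
    ('p, 'f, 'v) asp_rule \<Rightarrow> ('p, 'f, 'v) asp_rule" where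
  "simpl_rule \<gamma> i R r = Rule (hd_atoms r) (pos_body r - facts_in R)
     (neg_body r - {a. (\<exists>j<i. pred a \<in> \<gamma> ! j) \<and> a \<notin> heads_in R})"

definition Simpl :: "'p set list \<Rightarrow> nat \<Rightarrow> ('p, 'f, 'v) program \<Rightarrow>
    ('p, 'f, 'v) program \<Rightarrow> ('p, 'f, 'v) program" where
  "Simpl \<gamma> i T R = simpl_rule \<gamma> i R ` {r\<in>T. (hd_atoms r \<union> neg_body r) \<inter> facts_in R = {}}"

text \<open>Instantiation is over the ground terms of the whole program P, not of the module only.\<close>

definition Phi :: "('p, 'f, 'v) program \<Rightarrow> 'p set list \<Rightarrow> nat \<Rightarrow>
    ('p, 'f, 'v) program \<Rightarrow> ('p, 'f, 'v) program \<Rightarrow> ('p, 'f, 'v) program" where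
  "Phi P \<gamma> i R S = Simpl \<gamma> i (Inst (ground_terms P) (module P \<gamma> i) (heads_in (R \<union> S))) R"

lemma mono_Phi: "mono (Phi P \<gamma> i R)"
  by (rule monoI) (fastforce simp: Phi_def Simpl_def Inst_def heads_in_def)

primrec intelligent_inst ::
  "('p, 'f, 'v) program \<Rightarrow> 'p set list \<Rightarrow> nat \<Rightarrow> ('p, 'f, 'v) program" where
  "intelligent_inst P \<gamma> 0 = EDB P"
| "intelligent_inst P \<gamma> (Suc i) =
     intelligent_inst P \<gamma> i \<union> lfp (Phi P \<gamma> i (intelligent_inst P \<gamma> i))"

definition finitely_ground :: "('p, 'f, 'v) program \<Rightarrow> bool" where
  "finitely_ground P \<longleftrightarrow>
     (\<forall>\<gamma>. component_ordering P \<gamma> \<longrightarrow> finite (intelligent_inst P \<gamma> (length \<gamma>)))"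

end

(* A finite set A of atoms that is closed under the ground rules with positive body in A bounds every
   intelligent instantiation, whatever the component ordering. For DMS(Q, P) such a set consists of
   the relevant atoms, their magic versions and the EDB facts: a magic rule passes from a relevant
   head atom to an atom of the same ground rule, and the magic atoms in the body of a modified rule
   make its head atoms, hence all its atoms, relevant. *)

theory Submission
  imports Defs
begin

section \<open>Substitution\<close>

lemma subst_trm_ident: "vars_trm t = {} \<Longrightarrow> subst_trm \<sigma> t = t"
  by (induction t) (auto intro: map_idI)

lemma subst_atom_ident: "vars_atom a = {} \<Longrightarrow> subst_atom \<sigma> a = a"
  by (cases a) (auto simp: subst_atom_def vars_atom_def intro!: map_idI subst_trm_ident)

lemma subst_rule_ident:
  assumes "vars_rule r = {}"
  shows "subst_rule \<sigma> r = r"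
proof -
  have "subst_atom \<sigma> a = a" if "a \<in> atoms r" for a
    using assms that by (intro subst_atom_ident) (auto simp: vars_rule_def)
  then show ?thesis
    by (cases r) (auto simp: subst_rule_def atoms_def)
qed

lemma subst_trm_cong: "(\<And>x. x \<in> vars_trm t \<Longrightarrow> \<sigma> x = \<tau> x) \<Longrightarrow> subst_trm \<sigma> t = subst_trm \<tau> t"
  by (induction t) auto

lemma subst_atom_cong: "(\<And>x. x \<in> vars_atom a \<Longrightarrow> \<sigma> x = \<tau> x) \<Longrightarrow> subst_atom \<sigma> a = subst_atom \<tau> a"
  by (auto simp: subst_atom_def vars_atom_def intro!: subst_trm_cong)

lemma atoms_subst_rule: "atoms (subst_rule \<sigma> r) = subst_atom \<sigma> ` atoms r"
  by (auto simp: atoms_def subst_rule_def)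

text \<open>No variable can be mapped into the empty set, so only a variable-free rule has instances
  here, and substitution leaves it unchanged.\<close>

lemma instances_empty_universe: "rg \<in> instances {} r \<Longrightarrow> rg = r"
  by (auto simp: instances_def subst_rule_ident)

lemma is_fact_instances: "is_fact r \<Longrightarrow> rg \<in> instances U r \<Longrightarrow> rg = r"
  by (auto simp: instances_def is_fact_def subst_rule_ident)

text \<open>The nonempty heads required by \<open>is_program\<close> matter: they supply a non-IDB
  predicate defined by \<open>r\<close>, and every rule defining such a predicate is a fact.\<close>

lemma EDB_is_fact: "is_program P \<Longrightarrow> r \<in> EDB P \<Longrightarrow> is_fact r"
  by (force simp: EDB_def is_program_def idb_def defines_pred_def)


section \<open>A sufficient condition for finite groundness\<close>

lemma finite_rules_over:
  assumes "finite A"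
  shows "finite {r. atoms r \<subseteq> A}"
proof (rule finite_subset)
  show "{r. atoms r \<subseteq> A} \<subseteq> (\<lambda>(H, B, N). Rule H B N) ` (Pow A \<times> Pow A \<times> Pow A)"
  proof
    fix r assume "r \<in> {r. atoms r \<subseteq> A}"
    then have "r = (\<lambda>(H, B, N). Rule H B N) (hd_atoms r, pos_body r, neg_body r)"
      and "(hd_atoms r, pos_body r, neg_body r) \<in> Pow A \<times> Pow A \<times> Pow A"
      by (simp_all add: atoms_def)
    then show "r \<in> (\<lambda>(H, B, N). Rule H B N) ` (Pow A \<times> Pow A \<times> Pow A)"
      by (rule image_eqI)
  qed
qed (use assms in simp)

text \<open>Once the earlier stages consist of rules over \<open>A\<close>, the set of all rules
  over \<open>A\<close> is a prefixed point of \<open>Phi\<close>, because \<open>Simpl\<close> only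
  deletes rules and literals. It therefore contains the least fixpoint added at the next
  stage.\<close>

lemma finitely_ground_if_closed:
  assumes "finite A"
    and EDB: "\<And>r. r \<in> EDB M \<Longrightarrow> atoms r \<subseteq> A"
    and closed: "\<And>r rg. r \<in> M \<Longrightarrow> rg \<in> instances (ground_terms M) r \<Longrightarrow> pos_body rg \<subseteq> A
      \<Longrightarrow> atoms rg \<subseteq> A"
  shows "finitely_ground M"
proof -
  let ?F = "{r. atoms r \<subseteq> A}"
  have "intelligent_inst M \<gamma> i \<subseteq> ?F" for \<gamma> i
  proof (induction i)
    case 0
    then show ?case using EDB by auto
  next
    case (Suc i)
    let ?R = "intelligent_inst M \<gamma> i"
    have "heads_in (?R \<union> ?F) \<subseteq> A"
      using Suc by (auto simp: heads_in_def atoms_def)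
    then have "Inst (ground_terms M) (module M \<gamma> i) (heads_in (?R \<union> ?F)) \<subseteq> ?F"
      using closed by (fastforce simp: Inst_def module_def)
    then have "Phi M \<gamma> i ?R ?F \<subseteq> ?F"
      by (force simp: Phi_def Simpl_def simpl_rule_def atoms_def)
    then have "lfp (Phi M \<gamma> i ?R) \<subseteq> ?F" by (rule lfp_lowerbound)
    then show ?case using Suc by simp
  qed
  then show ?thesis
    using finite_rules_over[OF \<open>finite A\<close>] unfolding finitely_ground_def
    by (blast intro: finite_subset)
qed


section \<open>The magic set program\<close>

text \<open>Since \<open>DMS\<close> is a definite description, \<open>dms_output_ex1\<close> is
  needed to obtain an actual terminated run; \<open>dms_final\<close> gives its rule sets in closed
  form, and the origin of each rule is read off from them.\<close>

lemma DMS_cases: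
  assumes "is_program P" and "r \<in> DMS Q P"
  obtains (query) "r = Rule {magic_atom Q} {} {}"
  | (modified) s where "s \<in> P" "r = modify_rule s"
  | (magic) s a b where "s \<in> P" "a \<in> hd_atoms s" "b \<in> atoms s"
      "r = Rule {magic_atom b} {magic_atom a} {}"
  | (EDB) s where "s \<in> EDB P" "r = orig_rule s"
proof -
  have "dms_output Q P (DMS Q P)"
    unfolding DMS_def by (rule theI'[OF dms_output_ex1[OF assms(1)]])
  then obtain D mo ma
    where run: "(dms_step P)\<^sup>*\<^sup>* (dms_init Q) ({}, D, mo, ma)"
      and "DMS Q P = ma \<union> mo \<union> orig_rule ` EDB P"
    unfolding dms_output_def by blast
  then consider "r = Rule {magic_atom Q} {} {}" | p where "r \<in> magic_for P p"
    | p where "r \<in> modified_for P p" | "r \<in> orig_rule ` EDB P"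
    using assms(2) dms_final(2,3)[OF run] by auto
  then show thesis
  proof cases
    case 1
    then show thesis by (rule query)
  next
    case (2 p)
    then show thesis using magic unfolding magic_for_def by blast
  next
    case (3 p)
    then show thesis using modified unfolding modified_for_def by blast
  next
    case 4
    then show thesis using EDB by blast
  qed
qed

section \<open>Original and magic copies of atoms and rules\<close>

lemma orig_atom_eq [simp]: "orig_atom a = orig_atom b \<longleftrightarrow> a = b"
  and magic_atom_eq [simp]: "magic_atom a = magic_atom b \<longleftrightarrow> a = b"
  and orig_neq_magic [simp]: "orig_atom a \<noteq> magic_atom b" "magic_atom a \<noteq> orig_atom b"
  by (cases a; cases b; simp add: orig_atom_def magic_atom_def)+

lemma args_orig_magic [simp]: "args (orig_atom a) = args a" "args (magic_atom a) = args a"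
  by (simp_all add: orig_atom_def magic_atom_def)

lemma vars_orig_magic [simp]:
  "vars_atom (orig_atom a) = vars_atom a" "vars_atom (magic_atom a) = vars_atom a"
  by (simp_all add: vars_atom_def)

lemma subst_orig_magic [simp]:
  "subst_atom \<sigma> (orig_atom a) = orig_atom (subst_atom \<sigma> a)"
  "subst_atom \<sigma> (magic_atom a) = magic_atom (subst_atom \<sigma> a)"
  by (simp_all add: subst_atom_def orig_atom_def magic_atom_def)

lemma atoms_orig_rule: "atoms (orig_rule r) = orig_atom ` atoms r"
  by (auto simp: atoms_def orig_rule_def)

lemma atoms_modify_rule: "atoms (modify_rule r) = orig_atom ` atoms r \<union> magic_atom ` hd_atoms r"
  by (auto simp: atoms_def modify_rule_def)

lemma vars_modify_rule: "vars_rule (modify_rule r) = vars_rule r"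
  by (simp add: vars_rule_def atoms_modify_rule) (auto simp: atoms_def)

lemma subst_modify_rule: "subst_rule \<sigma> (modify_rule r) = modify_rule (subst_rule \<sigma> r)"
  by (simp add: subst_rule_def modify_rule_def image_image image_Un)

lemma is_fact_orig_rule:
  assumes "is_fact r"
  shows "is_fact (orig_rule r)"
proof -
  obtain a where "r = Rule {a} {} {}" and "vars_rule r = {}"
    using assms by (auto simp: is_fact_def)
  then show ?thesis by (auto simp: is_fact_def orig_rule_def vars_rule_def atoms_def)
qed

text \<open>The transformation renames predicates but creates no new argument tuples. This bounds
  both the function symbols and the atoms of \<open>DMS Q P\<close>.\<close>

lemma atoms_DMS:
  assumes "is_program P" and "r \<in> DMS Q P" and "c \<in> atoms r"
  obtains a where "a = Q \<or> (\<exists>s\<in>P. a \<in> atoms s)" and "c = orig_atom a \<or> c = magic_atom a"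
  using assms(1,2)
proof (cases rule: DMS_cases)
  case query
  then show ?thesis using assms(3) by (intro that[of Q]) (auto simp: atoms_def)
next
  case (modified s)
  then have "c \<in> orig_atom ` atoms s \<union> magic_atom ` atoms s"
    using assms(3) by (simp add: atoms_modify_rule) (auto simp: atoms_def)
  then show ?thesis using modified(1) that by blast
next
  case (magic s a b)
  then show ?thesis using assms(3) that by (auto simp: atoms_def)
next
  case (EDB s)
  then show ?thesis using assms(3) that by (auto simp: atoms_orig_rule EDB_def)
qed

text \<open>Only an inclusion: rules of predicates that are not reached may be dropped, together
  with their function symbols. It turns instances over the smaller universe into ground instances of
  \<open>P\<close>.\<close>

lemma ground_terms_DMS:
  assumes "is_program P" and "is_query P Q"
  shows "ground_terms (DMS Q P) \<subseteq> ground_terms P"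
proof -
  have "funs_trm t \<subseteq> funs_program P"
    if r: "r \<in> DMS Q P" and c: "c \<in> atoms r" and t: "t \<in> set (args c)" for r c t
  proof -
    obtain a where a: "a = Q \<or> (\<exists>s\<in>P. a \<in> atoms s)" and "c = orig_atom a \<or> c = magic_atom a"
      using atoms_DMS[OF assms(1) r c] by blast
    then have "t \<in> set (args a)" using t by auto
    then show ?thesis
      using a assms(2) by (auto simp: is_query_def ground_terms_def funs_program_def)
  qed
  then have "funs_program (DMS Q P) \<subseteq> funs_program P"
    unfolding funs_program_def[of "DMS Q P"] by blast
  then show ?thesis by (auto simp: ground_terms_def)
qed

lemma finite_atoms_DMS:
  assumes "is_program P"
  shows "finite (\<Union>r\<in>DMS Q P. atoms r)"
proof (rule finite_subset)
  let ?B = "insert Q (\<Union>s\<in>P. atoms s)"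
  show "(\<Union>r\<in>DMS Q P. atoms r) \<subseteq> orig_atom ` ?B \<union> magic_atom ` ?B"
    using atoms_DMS[OF assms] by blast
  show "finite (orig_atom ` ?B \<union> magic_atom ` ?B)"
    using assms by (auto simp: is_program_def)
qed

section \<open>Relevance passed along substitution instances of program rules\<close>

lemma relevant_subst:
  assumes "r \<in> P" and "\<And>x. x \<in> vars_rule r \<Longrightarrow> \<sigma> x \<in> ground_terms P"
    and "h \<in> hd_atoms r" and "subst_atom \<sigma> h \<in> relevant P Q" and "a \<in> atoms r"
  shows "subst_atom \<sigma> a \<in> relevant P Q"
proof (rule relevant.step)
  show "subst_rule \<sigma> r \<in> Ground P"
    using assms(1,2) by (auto simp: Ground_def instances_def)
  show "subst_atom \<sigma> h \<in> hd_atoms (subst_rule \<sigma> r)"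
    using assms(3) by (simp add: subst_rule_def)
  show "subst_atom \<sigma> a \<in> atoms (subst_rule \<sigma> r)"
    using assms(5) by (simp add: atoms_subst_rule)
qed (fact assms(4))

text \<open>A nonempty universe is needed because the rule may have variables that do not occur in
  either atom, as when it gives rise to a magic rule.\<close>

lemma relevant_subst_pair:
  assumes "r \<in> P" and "ground_terms P \<noteq> {}" and "a \<in> hd_atoms r" and "b \<in> atoms r"
    and \<sigma>: "\<And>x. x \<in> vars_atom a \<union> vars_atom b \<Longrightarrow> \<sigma> x \<in> ground_terms P"
    and "subst_atom \<sigma> a \<in> relevant P Q"
  shows "subst_atom \<sigma> b \<in> relevant P Q"
proof -
  obtain u where u: "u \<in> ground_terms P" using assms(2) by blast
  \<comment> \<open>\<open>\<tau>\<close> grounds the whole rule without changing the instance of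
    either atom.\<close>
  define \<tau> where "\<tau> x = (if x \<in> vars_atom a \<union> vars_atom b then \<sigma> x else u)" for x
  have eq: "subst_atom \<tau> a = subst_atom \<sigma> a" "subst_atom \<tau> b = subst_atom \<sigma> b"
    by (auto simp: \<tau>_def intro!: subst_atom_cong)
  have "subst_atom \<tau> b \<in> relevant P Q"
    using assms(1) _ assms(3) _ assms(4)
    by (rule relevant_subst) (use \<sigma> u assms(6) eq in \<open>auto simp: \<tau>_def\<close>)
  then show ?thesis by (simp add: eq)
qed

theorem theorem4:
  fixes P :: "('p, 'f, 'v) program" and Q :: "('p, 'f, 'v) atom"
  assumes "ASP_fs P"
    and "is_query P Q"
    and "finitely_recursive P Q"
  shows "finitely_ground (DMS Q P)"
proof (cases "ground_terms P = {}")
  \<comment> \<open>Over an empty universe a rule with variables has no ground instance, yet a magic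
    rule made from it may be variable-free, so its head need not come from a relevant atom. Here the
    atoms of \<open>DMS Q P\<close> themselves form the closed set, as every instance is the rule
    itself.\<close>
  case True
  have P: "is_program P" using assms(1) by (simp add: ASP_fs_def)
  then have "ground_terms (DMS Q P) = {}" using ground_terms_DMS[OF P assms(2)] True by simp
  then show ?thesis
    by (intro finitely_ground_if_closed[OF finite_atoms_DMS[OF P]])
      (auto simp: EDB_def dest!: instances_empty_universe)
next
  case False
  have P: "is_program P" using assms(1) by (simp add: ASP_fs_def)
  let ?U = "ground_terms (DMS Q P)"
  let ?rel = "relevant P Q"
  \<comment> \<open>EDB facts are kept in the output whether relevant or not, hence the third
    part.\<close>
  define A where "A = orig_atom ` ?rel \<union> magic_atom ` ?rel \<union> orig_atom ` (\<Union>s\<in>EDB P. atoms s)"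
  \<comment> \<open>Magic atoms enter \<open>A\<close> only through relevant atoms, so a magic body
    atom can be turned back into relevance; an original atom of \<open>A\<close> may be an
    irrelevant EDB fact.\<close>
  have magic_A: "magic_atom a \<in> A \<longleftrightarrow> a \<in> ?rel" for a
    by (auto simp: A_def)
  have closed: "atoms rg \<subseteq> A"
    if r: "r \<in> DMS Q P" and rg: "rg \<in> instances ?U r" and sub: "pos_body rg \<subseteq> A" for r rg
  proof -
    obtain \<sigma> where eq: "rg = subst_rule \<sigma> r"
      and "\<And>x. x \<in> vars_rule r \<Longrightarrow> \<sigma> x \<in> ?U"
      using rg by (auto simp: instances_def)
    then have \<sigma>: "\<And>x. x \<in> vars_rule r \<Longrightarrow> \<sigma> x \<in> ground_terms P"
      using ground_terms_DMS[OF P assms(2)] by blast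
    from P r show ?thesis
    proof (cases rule: DMS_cases)
      case query
      have "vars_atom Q = {}"
        using assms(2) by (auto simp: is_query_def ground_terms_def vars_atom_def)
      then have "is_fact r" by (simp add: query is_fact_def vars_rule_def atoms_def)
      then have "rg = r" using rg by (rule is_fact_instances)
      then show ?thesis by (auto simp: query atoms_def magic_A relevant.query)
    next
      case (modified s)
      have heads: "subst_atom \<sigma> h \<in> ?rel" if "h \<in> hd_atoms s" for h
      proof -
        have "magic_atom (subst_atom \<sigma> h) \<in> pos_body rg"
          using that unfolding eq modified(2) subst_modify_rule
          by (auto simp: modify_rule_def subst_rule_def)
        then show ?thesis using sub magic_A by blast
      qed
      \<comment> \<open>Some head atom exists, and its relevance passes to all atoms of the
        rule.\<close>
      obtain h where h: "h \<in> hd_atoms s"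
        using P modified by (auto simp: is_program_def)
      have "subst_atom \<sigma> a \<in> ?rel" if "a \<in> atoms s" for a
        by (rule relevant_subst[OF modified(1) _ h heads[OF h] that])
          (use \<sigma> modified in \<open>simp add: vars_modify_rule\<close>)
      then show ?thesis
        using heads unfolding eq modified(2) atoms_subst_rule atoms_modify_rule
        by (auto simp: A_def)
    next
      case (magic s a b)
      have a: "subst_atom \<sigma> a \<in> ?rel"
        using sub by (simp add: eq magic subst_rule_def magic_A)
      \<comment> \<open>\<open>\<sigma>\<close> is controlled only on the variables of
        \<open>a\<close> and \<open>b\<close>, not on all those of \<open>s\<close>.\<close>
      have "subst_atom \<sigma> b \<in> ?rel"
        by (rule relevant_subst_pair[OF magic(1) False magic(2,3) _ a])
          (use \<sigma> in \<open>auto simp: magic vars_rule_def atoms_def\<close>)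
      then show ?thesis
        using a by (simp add: eq magic atoms_def subst_rule_def magic_A)
    next
      case (EDB s)
      have "is_fact r"
        using EDB_is_fact[OF P EDB(1)] by (simp add: EDB is_fact_orig_rule)
      then have "rg = r" using rg by (rule is_fact_instances)
      then show ?thesis using EDB by (auto simp: A_def atoms_orig_rule)
    qed
  qed
  have "finite (\<Union>s\<in>EDB P. atoms s)"
    using P by (auto simp: is_program_def EDB_def)
  then have "finite A"
    using assms(3) by (simp add: A_def finitely_recursive_def)
  \<comment> \<open>The EDB part of the output may also contain the magic fact for \<open>Q\<close>.
    Each of its rules is a fact, hence its own instance with empty body, so \<open>closed\<close>
    applies.\<close>
  moreover have "atoms r \<subseteq> A" if "r \<in> EDB (DMS Q P)" for r
  proof -
    have r: "r \<in> DMS Q P" using that by (simp add: EDB_def)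
    \<comment> \<open>A rule with empty head would lie in the EDB part vacuously, without being a
      fact.\<close>
    then have "hd_atoms r \<noteq> {}"
      using P by (cases rule: DMS_cases[OF P r])
        (auto simp: modify_rule_def orig_rule_def is_program_def EDB_def)
    then have fact: "is_fact r"
      using that by (force simp: EDB_def idb_def defines_pred_def)
    then have "r \<in> instances ?U r"
      by (auto simp: instances_def is_fact_def subst_rule_ident)
    then show ?thesis
      by (rule closed[OF r]) (use fact in \<open>auto simp: is_fact_def\<close>)
  qed
  ultimately show ?thesis using closed by (rule finitely_ground_if_closed)
qed

end
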